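(* Let $A$ be an $n\times k$ matrix with real entries. Then $$\det(A^tA)=\sum_{I\subset\{1,\ldots,n\},\ |I|=k}\det(A_I)^2 .$$ That is, the square of the $k$-dimensional content of the parallelepiped in $\mathbb{R}^n$ spanned by the columns of $A$ is equal to the sum, over all $k$-element subsets $I\subset\{1,\ldots,n\}$, of the squares of the $k$-dimensional contents of the orthogonal projections of this parallelepiped into the $k$-dimensional coordinate hyperplanes determined by $I$.
   Context: $A^t$ denotes the transpose of $A$, and $|I|$ denotes the cardinality of $I$. For $I\subset\{1,\ldots,n\}$ with $k$ elements, $A_I$ is the $k\times k$ matrix made from the rows of $A$ whose indices lie in $I$, taken in increasing order. The parallelepiped spanned by vectors $v_1,\ldots,v_k$ is $\{\sum_{i=1}^k\lambda_i v_i : \lambda_i\in[0,1]\}$. The $k$-dimensional content of the parallelepiped spanned by the $k$ columns of an $m\times k$ real matrix $B$ is $\sqrt{\det(B^tB)}$ (in particular it is $|\det B|$ if $m=k$). The $k$-dimensional coordinate hyperplane determined by $I$ is the span of the standard basis vectors $e_i$, $i\in I$, identified with $\mathbb{R}^k$; the orthogonal projection into it of the parallelepiped spanned by the columns of $A$ is the parallelepiped spanned by the columns of $A_I$. If $k>n$ the sum is empty and equals $0$. *)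

theory Defs
  imports
    Complex_Main
    "Jordan_Normal_Form.Determinant"
    "Jordan_Normal_Form.VS_Connect"
    "Jordan_Normal_Form.DL_Submatrix"
begin

text \<open>Rows, columns and coordinates are numbered from \<open>0\<close>.  For \<open>I \<subseteq> {..<n}\<close> and an
  \<open>n \<times> k\<close> matrix \<open>A\<close>, the matrix made from the rows of \<open>A\<close> with index in \<open>I\<close>, in increasing
  order, is \<open>submatrix A I UNIV\<close>; the library function \<open>pick I\<close> enumerates \<open>I\<close> increasingly.\<close>

definition parallelepiped :: "real mat \<Rightarrow> real vec set" where
  "parallelepiped B =
     {B *\<^sub>v l | l. l \<in> carrier_vec (dim_col B) \<and> (\<forall>i < dim_col B. 0 \<le> l $ i \<and> l $ i \<le> 1)}"

text \<open>The content is a function of the set only.  It does not depend on the spanning columns,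
  by \<open>parallelepiped_content_eq\<close> below; on a set that is not a parallelepiped spanned by
  \<open>k\<close> vectors the value is unspecified.\<close>

definition parallelepiped_content :: "nat \<Rightarrow> real vec set \<Rightarrow> real" where
  "parallelepiped_content k P =
     (THE c. \<exists>m. \<exists>B \<in> carrier_mat m k. P = parallelepiped B \<and> c = sqrt (det (B\<^sup>T * B)))"

definition coordinate_plane :: "nat \<Rightarrow> nat set \<Rightarrow> real vec set" where
  "coordinate_plane n I =
     LinearCombinations.module.span class_ring (module_vec TYPE(real) n) (unit_vec n ` I)"

definition orthogonal_projection :: "real vec set \<Rightarrow> real vec \<Rightarrow> real vec" where
  "orthogonal_projection W x = (THE y. y \<in> W \<and> (\<forall>w \<in> W. (x - y) \<bullet> w = 0))"

text \<open>The identification of \<open>coordinate_plane n I\<close> with the space of real vectors of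
  dimension \<open>card I\<close>.\<close>

definition plane_coordinates :: "nat set \<Rightarrow> real vec \<Rightarrow> real vec" where
  "plane_coordinates I y = vec (card I) (\<lambda>i. y $ pick I i)"

definition coordinate_projection :: "nat \<Rightarrow> nat set \<Rightarrow> real vec \<Rightarrow> real vec" where
  "coordinate_projection n I x =
     plane_coordinates I (orthogonal_projection (coordinate_plane n I) x)"

lemma abs_det_le_1:
  fixes C :: "real mat"
  assumes "C \<in> carrier_mat k k"
    and "\<And>i. i < k \<Longrightarrow> (\<Sum>j<k. \<bar>C $$ (i,j)\<bar>) \<le> 1"
  shows "\<bar>det C\<bar> \<le> 1"
  using assms
proof (induction k arbitrary: C)
  case 0
  then show ?case by (simp add: det_dim_zero)
next
  case (Suc k)
  have cof: "\<bar>cofactor C 0 j\<bar> \<le> 1" if j: "j < Suc k" for j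
  proof -
    have "\<bar>det (mat_delete C 0 j)\<bar> \<le> 1"
    proof (rule Suc.IH)
      show md: "mat_delete C 0 j \<in> carrier_mat k k"
        using Suc.prems(1) by (simp add: mat_delete_def)
      fix i assume i: "i < k"
      define g where "g l = (if l < j then l else Suc l)" for l
      have inj: "inj_on g {..<k}" by (auto simp: inj_on_def g_def split: if_splits)
      have sub: "g ` {..<k} \<subseteq> {..<Suc k}" by (auto simp: g_def)
      have "(\<Sum>l<k. \<bar>mat_delete C 0 j $$ (i,l)\<bar>) = (\<Sum>l<k. \<bar>C $$ (Suc i, g l)\<bar>)"
        using Suc.prems(1) i by (intro sum.cong) (auto simp: mat_delete_def g_def)
      also have "\<dots> = (\<Sum>l \<in> g ` {..<k}. \<bar>C $$ (Suc i, l)\<bar>)"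
        by (simp add: sum.reindex[OF inj])
      also have "\<dots> \<le> (\<Sum>l<Suc k. \<bar>C $$ (Suc i, l)\<bar>)"
        by (rule sum_mono2) (use sub in auto)
      also have "\<dots> \<le> 1" using Suc.prems(2)[of "Suc i"] i by blast
      finally show "(\<Sum>l<k. \<bar>mat_delete C 0 j $$ (i,l)\<bar>) \<le> 1" .
    qed
    then show ?thesis by (simp add: cofactor_def abs_mult power_abs)
  qed
  have "\<bar>det C\<bar> = \<bar>\<Sum>j<Suc k. C $$ (0,j) * cofactor C 0 j\<bar>"
    using laplace_expansion_row[OF Suc.prems(1), of 0] by simp
  also have "\<dots> \<le> (\<Sum>j<Suc k. \<bar>C $$ (0,j) * cofactor C 0 j\<bar>)" by (rule sum_abs)
  also have "\<dots> \<le> (\<Sum>j<Suc k. \<bar>C $$ (0,j)\<bar>)"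
    by (intro sum_mono) (use cof in \<open>simp add: abs_mult mult_left_le\<close>)
  also have "\<dots> \<le> 1" using Suc.prems(2)[of 0] by blast
  finally show ?case .
qed

lemma parallelepiped_colD:
  assumes B: "B \<in> carrier_mat m k" and B': "B' \<in> carrier_mat m' k"
    and sub: "parallelepiped B' \<subseteq> parallelepiped B"
  shows "m' = m"
    and "\<exists>C \<in> carrier_mat k k. B' = B * C \<and> (\<forall>i<k. \<forall>j<k. 0 \<le> C $$ (i,j))"
proof -
  have in_P: "B' *\<^sub>v l \<in> parallelepiped B"
    if "l \<in> carrier_vec k" "\<And>i. i < k \<Longrightarrow> 0 \<le> l $ i \<and> l $ i \<le> 1" for l
  proof -
    have "B' *\<^sub>v l \<in> parallelepiped B'" using that B' unfolding parallelepiped_def by auto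
    then show ?thesis using sub by auto
  qed
  have "B' *\<^sub>v 0\<^sub>v k \<in> parallelepiped B" by (rule in_P) simp_all
  then obtain l where "B' *\<^sub>v 0\<^sub>v k = B *\<^sub>v l" unfolding parallelepiped_def by blast
  then have "dim_vec (B' *\<^sub>v 0\<^sub>v k) = dim_vec (B *\<^sub>v l)" by (rule arg_cong)
  then show m: "m' = m" unfolding dim_mult_mat_vec using carrier_matD(1)[OF B] carrier_matD(1)[OF B'] by simp
  have "\<exists>l \<in> carrier_vec k. col B' j = B *\<^sub>v l \<and> (\<forall>i<k. 0 \<le> l $ i)" if j: "j < k" for j
  proof -
    have "B' *\<^sub>v unit_vec k j = col B' j"
    proof (rule eq_vecI)
      fix i assume i: "i < dim_vec (col B' j)"
      then have "(B' *\<^sub>v unit_vec k j) $ i = row B' i \<bullet> unit_vec k j" by simp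
      also have "\<dots> = row B' i $ j" using B' j by (intro scalar_prod_right_unit) auto
      finally show "(B' *\<^sub>v unit_vec k j) $ i = col B' j $ i" using B' i j by simp
    qed simp
    moreover have "B' *\<^sub>v unit_vec k j \<in> parallelepiped B"
      using j by (intro in_P) (simp_all add: unit_vec_def)
    ultimately have "col B' j \<in> parallelepiped B" by simp
    then obtain l where "col B' j = B *\<^sub>v l" "l \<in> carrier_vec (dim_col B)"
      "\<forall>i < dim_col B. 0 \<le> l $ i \<and> l $ i \<le> 1"
      unfolding parallelepiped_def by blast
    then show ?thesis using B by blast
  qed
  then have "\<forall>j. \<exists>l. j < k \<longrightarrow> l \<in> carrier_vec k \<and> col B' j = B *\<^sub>v l \<and> (\<forall>i<k. 0 \<le> l $ i)"
    by blast
  from choice[OF this] obtain l where l: "\<And>j. j < k \<Longrightarrow> l j \<in> carrier_vec k"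
    "\<And>j. j < k \<Longrightarrow> col B' j = B *\<^sub>v l j" "\<And>j i. j < k \<Longrightarrow> i < k \<Longrightarrow> 0 \<le> l j $ i"
    by blast
  define C where "C = mat k k (\<lambda>(i,j). l j $ i)"
  have C: "C \<in> carrier_mat k k" by (simp add: C_def)
  have colC: "col C j = l j" if "j < k" for j
    using l(1)[OF that] that by (intro eq_vecI) (auto simp: C_def)
  have "B' = B * C"
  proof (rule mat_col_eqI)
    fix j assume "j < dim_col (B * C)"
    then have j: "j < k" using C by simp
    show "col B' j = col (B * C) j"
      using l(2)[OF j] colC[OF j] col_mult2[OF B C j] by simp
  qed (use B B' C m in auto)
  moreover have "\<forall>i<k. \<forall>j<k. 0 \<le> C $$ (i,j)" using l(3) by (auto simp: C_def)
  ultimately show "\<exists>C \<in> carrier_mat k k. B' = B * C \<and> (\<forall>i<k. \<forall>j<k. 0 \<le> C $$ (i,j))"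
    using C by blast
qed

lemma gram_injective:
  fixes B :: "real mat"
  assumes B: "B \<in> carrier_mat m k" and d: "det (B\<^sup>T * B) \<noteq> 0"
    and x: "x \<in> carrier_vec k" and y: "y \<in> carrier_vec k" and eq: "B *\<^sub>v x = B *\<^sub>v y"
  shows "x = y"
proof -
  have BtB: "B\<^sup>T * B \<in> carrier_mat k k" using B by simp
  have "(B\<^sup>T * B) *\<^sub>v (x - y) = B\<^sup>T *\<^sub>v (B *\<^sub>v (x - y))"
    using B x y by (intro assoc_mult_mat_vec) auto
  also have "B *\<^sub>v (x - y) = 0\<^sub>v m"
    using B x y eq by (subst mult_minus_distrib_mat_vec[of _ m k]) auto
  also have "B\<^sup>T *\<^sub>v 0\<^sub>v m = 0\<^sub>v k" using B by (intro eq_vecI) auto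
  finally have 0: "(B\<^sup>T * B) *\<^sub>v (x - y) = 0\<^sub>v k" .
  have xy: "x - y \<in> carrier_vec k" using x y by (rule minus_carrier_vec)
  have "x - y = 0\<^sub>v k"
    using det_0_iff_vec_prod_zero[OF BtB] d 0 xy by blast
  then have zero: "(x - y) $ i = 0" if "i < k" for i using that by simp
  show "x = y"
  proof (rule eq_vecI)
    fix i assume "i < dim_vec y"
    then have "i < k" using y by simp
    then show "x $ i = y $ i" using zero[of i] y by (simp add: index_minus_vec)
  qed (use x y in simp)
qed

lemma parallelepiped_gram:
  fixes B B' :: "real mat"
  assumes B: "B \<in> carrier_mat m k" and B': "B' \<in> carrier_mat m' k"
    and sub: "parallelepiped B' \<subseteq> parallelepiped B"
  shows "\<exists>d. 0 \<le> d \<and> d \<le> 1 \<and> det (B'\<^sup>T * B') = d * det (B\<^sup>T * B)"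
proof -
  from parallelepiped_colD(2)[OF assms]
  obtain C where C: "C \<in> carrier_mat k k" and B'C: "B' = B * C"
    and pos: "\<And>i j. i < k \<Longrightarrow> j < k \<Longrightarrow> 0 \<le> C $$ (i,j)" by blast
  have BtB: "B\<^sup>T * B \<in> carrier_mat k k" using B by simp
  have "B'\<^sup>T * B' = C\<^sup>T * B\<^sup>T * (B * C)"
    unfolding B'C transpose_mult[OF B C] ..
  also have "\<dots> = C\<^sup>T * (B\<^sup>T * (B * C))"
    by (rule assoc_mult_mat[of _ k k _ m _ k]) (use B C in auto)
  also have "B\<^sup>T * (B * C) = B\<^sup>T * B * C"
    by (rule assoc_mult_mat[symmetric, of _ k m _ k _ k]) (use B C in auto)
  finally have "det (B'\<^sup>T * B') = det (C\<^sup>T * (B\<^sup>T * B * C))" by (rule arg_cong)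
  also have "\<dots> = det (C\<^sup>T) * det (B\<^sup>T * B * C)"
    by (rule det_mult[of _ k]) (use B C in auto)
  also have "det (B\<^sup>T * B * C) = det (B\<^sup>T * B) * det C" by (rule det_mult[OF BtB C])
  finally have gram: "det (B'\<^sup>T * B') = (det C)\<^sup>2 * det (B\<^sup>T * B)"
    by (simp add: det_transpose[OF C] power2_eq_square)
  show ?thesis
  proof (cases "det (B\<^sup>T * B) = 0")
    case True
    then show ?thesis using gram by (intro exI[of _ 0]) simp
  next
    case False
    define u where "u = vec k (\<lambda>_. 1 :: real)"
    have u: "u \<in> carrier_vec k" by (simp add: u_def)
    have "B' *\<^sub>v u \<in> parallelepiped B'" using B' u unfolding parallelepiped_def u_def by auto
    then obtain l where l: "l \<in> carrier_vec k" "\<And>i. i < k \<Longrightarrow> l $ i \<le> 1" and "B' *\<^sub>v u = B *\<^sub>v l"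
      using sub B unfolding parallelepiped_def by auto
    then have "B *\<^sub>v (C *\<^sub>v u) = B *\<^sub>v l" using B C u B'C by (simp add: assoc_mult_mat_vec)
    then have Cu: "C *\<^sub>v u = l"
      by (rule gram_injective[OF B False, rotated 2]) (use C u l in auto)
    have "\<bar>det C\<bar> \<le> 1"
    proof (rule abs_det_le_1[OF C])
      fix i assume i: "i < k"
      have "(\<Sum>j<k. \<bar>C $$ (i,j)\<bar>) = (\<Sum>j<k. C $$ (i,j))" using pos i by simp
      also have "\<dots> = (C *\<^sub>v u) $ i"
        using C i by (simp add: u_def scalar_prod_def atLeast0LessThan)
      also have "\<dots> \<le> 1" using Cu l i by simp
      finally show "(\<Sum>j<k. \<bar>C $$ (i,j)\<bar>) \<le> 1" .
    qed
    then have "(det C)\<^sup>2 \<le> 1" by (simp add: abs_square_le_1)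
    then show ?thesis using gram by (intro exI[of _ "(det C)\<^sup>2"]) simp
  qed
qed

theorem parallelepiped_content_eq:
  assumes B: "B \<in> carrier_mat m k"
  shows "parallelepiped_content k (parallelepiped B) = sqrt (det (B\<^sup>T * B))"
  unfolding parallelepiped_content_def
proof (rule the_equality)
  fix c assume "\<exists>m'. \<exists>B' \<in> carrier_mat m' k.
    parallelepiped B = parallelepiped B' \<and> c = sqrt (det (B'\<^sup>T * B'))"
  then obtain m' B' where B': "B' \<in> carrier_mat m' k" and eq: "parallelepiped B = parallelepiped B'"
    and c: "c = sqrt (det (B'\<^sup>T * B'))" by blast
  obtain d where d: "0 \<le> d" "d \<le> 1" "det (B'\<^sup>T * B') = d * det (B\<^sup>T * B)"
    using parallelepiped_gram[OF B B' equalityD2[OF eq]] by blast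
  obtain e where e: "0 \<le> e" "e \<le> 1" "det (B\<^sup>T * B) = e * det (B'\<^sup>T * B')"
    using parallelepiped_gram[OF B' B equalityD1[OF eq]] by blast
  have "det (B'\<^sup>T * B') = det (B\<^sup>T * B)"
  proof (cases "det (B\<^sup>T * B) = 0")
    case True
    then show ?thesis unfolding d(3) by simp
  next
    case False
    have "e * d * det (B\<^sup>T * B) = 1 * det (B\<^sup>T * B)"
      using e(3) unfolding d(3) by (simp only: mult.assoc mult_1)
    then have "e * d = 1" by (rule mult_right_cancel[OF False, THEN iffD1])
    moreover have "e * d \<le> d" using d(1) e(1,2) by (simp add: mult_left_le_one_le)
    ultimately have "d = 1" using d(2) by linarith
    then show ?thesis unfolding d(3) by simp
  qed
  then show "c = sqrt (det (B\<^sup>T * B))" unfolding c by simp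
qed (use B in blast)

end

theory Submission
  imports Defs
begin

text \<open>The first formula is the Cauchy--Binet formula for the product \<open>A\<^sup>T * A\<close>.  Expanding
  \<open>det (P * Q)\<close> multilinearly in the rows gives a sum over maps \<open>f\<close> from the \<open>k\<close> row indices to
  the summation range, in which only the injective maps contribute.  Grouping these by their
  image \<open>I\<close> and reading the same expansion backwards, with the summation range cut down to \<open>I\<close>,
  identifies the contribution of \<open>I\<close> as \<open>det (P\<^sub>I * Q\<^sub>I) = det P\<^sub>I * det Q\<^sub>I\<close>.  The second
  formula follows, because the orthogonal projection to a coordinate plane just drops the other
  coordinates.\<close>

text \<open>The index can be recovered from the value: exactly \<open>i\<close> elements of
  \<open>I\<close> lie below \<open>pick I i\<close>.\<close>

lemma inj_on_pick: "inj_on (pick I) {..<card I}"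
proof (rule inj_onI)
  fix i j assume ij: "i \<in> {..<card I}" "j \<in> {..<card I}" and eq: "pick I i = pick I j"
  have "i = card {a \<in> I. a < pick I i}" using ij by (simp add: card_pick_le)
  also have "\<dots> = j" unfolding eq using ij by (simp add: card_pick_le)
  finally show "i = j" .
qed

lemma bij_betw_pick:
  assumes "finite I"
  shows "bij_betw (pick I) {..<card I} I"
  unfolding bij_betw_def
proof
  have "pick I ` {..<card I} \<subseteq> I" using pick_in_set_le by blast
  moreover have "card (pick I ` {..<card I}) = card I"
    using card_image[OF inj_on_pick, of I] by simp
  ultimately show "pick I ` {..<card I} = I" by (rule card_subset_eq[OF assms])
qed (rule inj_on_pick)

lemma
  assumes "A \<in> carrier_mat n k" "I \<subseteq> {..<n}"
  shows submatrix_rows_carrier: "submatrix A I UNIV \<in> carrier_mat (card I) k"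
    and submatrix_rows_index:
      "i < card I \<Longrightarrow> j < k \<Longrightarrow> submatrix A I UNIV $$ (i, j) = A $$ (pick I i, j)"
proof -
  \<comment> \<open>\<open>submatrix\<close> counts only the indices of \<open>I\<close> below the
    row dimension; here that is all of \<open>I\<close>.\<close>
  have "{i. i < n \<and> i \<in> I} = I" using assms(2) by auto
  then show "submatrix A I UNIV \<in> carrier_mat (card I) k"
    and "i < card I \<Longrightarrow> j < k \<Longrightarrow> submatrix A I UNIV $$ (i, j) = A $$ (pick I i, j)"
    using assms(1) by (auto simp: submatrix_def pick_UNIV)
qed

text \<open>Row \<open>i\<close> is a combination of the rows \<open>q j\<close> with coefficients
  \<open>p i j\<close>, so multilinearity gives one term for each choice \<open>f\<close> of
  summands. If \<open>f\<close> takes a value twice, two rows are multiples of the same vector and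
  the term vanishes. Fixing \<open>f\<close> outside \<open>{0..<k}\<close> counts each choice once.
  \<open>J\<close> is left arbitrary because both the full range and a single \<open>I\<close> are
  needed later.\<close>

lemma det_linear_rows_sum_injective:
  fixes p q :: "nat \<Rightarrow> nat \<Rightarrow> 'a :: idom"
  assumes J: "finite J"
  shows "det (mat k k (\<lambda>(i, l). \<Sum>j\<in>J. p i j * q j l)) =
    (\<Sum>f | (\<forall>i\<in>{0..<k}. f i \<in> J) \<and> (\<forall>i. i \<notin> {0..<k} \<longrightarrow> f i = i) \<and> inj_on f {0..<k}.
      det (mat k k (\<lambda>(i, l). p i (f i) * q (f i) l)))"
    (is "?L = sum ?g ?F")
proof -
  let ?G = "{f. (\<forall>i\<in>{0..<k}. f i \<in> J) \<and> (\<forall>i. i \<notin> {0..<k} \<longrightarrow> f i = i)}"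
  let ?a = "\<lambda>i j. p i j \<cdot>\<^sub>v vec k (q j)"
  have "?L = det (mat\<^sub>r k k (\<lambda>i. finsum_vec TYPE('a) k (?a i) J))"
    by (intro arg_cong[where f = det] eq_matI) (auto simp: index_finsum_vec[OF J])
  also have "\<dots> = (\<Sum>f\<in>?G. det (mat\<^sub>r k k (\<lambda>i. ?a i (f i))))"
    by (rule det_linear_rows_sum[OF J]) auto
  also have "\<dots> = sum ?g ?G"
    by (intro sum.cong refl arg_cong[where f = det] eq_matI) auto
  also have "\<dots> = sum ?g ?F"
  proof (rule sum.mono_neutral_right)
    show "finite ?G" using finite_bounded_functions[OF J finite_atLeastLessThan, of 0 k] .
    show "\<forall>f\<in>?G - ?F. ?g f = 0"
    proof
      fix f assume "f \<in> ?G - ?F"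
      then obtain i j where ij: "i < k" "j < k" "i \<noteq> j" "f i = f j"
        by (auto simp: inj_on_def)
      have "?g f = det (mat\<^sub>r k k (\<lambda>i. p i (f i) \<cdot>\<^sub>v vec k (q (f i))))"
        by (intro arg_cong[where f = det] eq_matI) auto
      also have "\<dots> = (\<Prod>i = 0..<k. p i (f i)) * det (mat\<^sub>r k k (\<lambda>i. vec k (q (f i))))"
        by (rule det_rows_mul) auto
      also have "det (mat\<^sub>r k k (\<lambda>i. vec k (q (f i)))) = 0"
        using ij by (intro det_identical_rows[of _ k i j]) auto
      finally show "?g f = 0" by simp
    qed
  qed auto
  finally show ?thesis .
qed

theorem Cauchy_Binet:
  fixes P Q :: "'a :: idom mat"
  assumes P: "P \<in> carrier_mat k n" and Q: "Q \<in> carrier_mat n k"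
  shows "det (P * Q) = (\<Sum>I | I \<subseteq> {..<n} \<and> card I = k.
    det (submatrix P UNIV I) * det (submatrix Q I UNIV))"
proof -
  define F where "F J = {f. (\<forall>i\<in>{0..<k}. f i \<in> J) \<and> (\<forall>i. i \<notin> {0..<k} \<longrightarrow> f i = i)
    \<and> inj_on f {0..<k}}" for J :: "nat set"
  \<comment> \<open>\<open>M J\<close> is \<open>P * Q\<close> with its inner sum restricted to
    \<open>J\<close>. \<open>det_M\<close> expands it at \<open>J = {..<n}\<close> and folds the
    terms back at \<open>J = I\<close>.\<close>
  define M where "M J = mat k k (\<lambda>(i, l). \<Sum>j\<in>J. P $$ (i, j) * Q $$ (j, l))" for J
  define g where "g f = det (mat k k (\<lambda>(i, l). P $$ (i, f i) * Q $$ (f i, l)))" for f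
  let ?S = "{I. I \<subseteq> {..<n} \<and> card I = k}"
  have det_M: "det (M J) = sum g (F J)" if "finite J" for J
    unfolding M_def F_def g_def by (rule det_linear_rows_sum_injective[OF that])
  have finF: "finite (F {..<n})"
    by (rule finite_subset[OF _ finite_bounded_functions[of "{..<n}" "{0..<k}"]])
      (auto simp: F_def)
  have "P * Q = M {..<n}"
    using P Q by (intro eq_matI) (auto simp: M_def scalar_prod_def atLeast0LessThan)
  then have "det (P * Q) = sum g (F {..<n})" by (simp add: det_M)
  also have "\<dots> = (\<Sum>I\<in>?S. sum g {f \<in> F {..<n}. f ` {0..<k} = I})"
    by (rule sum.group[OF finF, symmetric]) (auto simp: F_def card_image)
  also have "\<dots> = (\<Sum>I\<in>?S. det (submatrix P UNIV I) * det (submatrix Q I UNIV))"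
  proof (rule sum.cong)
    fix I assume "I \<in> ?S"
    \<comment> \<open>Finiteness comes from \<open>I \<subseteq> {..<n}\<close>: for
      \<open>k = 0\<close> the cardinality alone would allow infinite sets.\<close>
    then have I: "I \<subseteq> {..<n}" "card I = k" and finI: "finite I" by (auto intro: finite_subset)
    have "{j. j < n \<and> j \<in> I} = I" using I by auto
    then have P': "submatrix P UNIV I \<in> carrier_mat k k"
      and P'_index: "\<And>i j. i < k \<Longrightarrow> j < k \<Longrightarrow> submatrix P UNIV I $$ (i, j) = P $$ (i, pick I j)"
      using P I by (auto simp: submatrix_def pick_UNIV)
    have Q': "submatrix Q I UNIV \<in> carrier_mat k k"
      using submatrix_rows_carrier[OF Q I(1)] I(2) by simp
    \<comment> \<open>An injection of \<open>k\<close> indices into a set of size \<open>k\<close>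
      is onto, so the maps with image \<open>I\<close> are all of \<open>F I\<close>, which is what
      \<open>det_M\<close> sums over.\<close>
    have "f ` {0..<k} = I" if "f \<in> F I" for f
      using that I finI by (intro card_subset_eq) (auto simp: F_def card_image)
    then have "{f \<in> F {..<n}. f ` {0..<k} = I} = F I"
      using I by (auto simp: F_def)
    then have "sum g {f \<in> F {..<n}. f ` {0..<k} = I} = det (M I)" by (simp add: det_M finI)
    also have "M I = submatrix P UNIV I * submatrix Q I UNIV" (is "_ = ?P * ?Q")
    proof (rule eq_matI)
      fix i l assume "i < dim_row (?P * ?Q)" "l < dim_col (?P * ?Q)"
      then have il: "i < k" "l < k" using P' Q' by auto
      \<comment> \<open>Running through \<open>I\<close> along \<open>pick I\<close> turns the
        restricted sum into the inner sum of the product of the two submatrices.\<close>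
      have "M I $$ (i, l) = (\<Sum>j<k. P $$ (i, pick I j) * Q $$ (pick I j, l))"
        using sum.reindex_bij_betw[OF bij_betw_pick[OF finI],
            of "\<lambda>j. P $$ (i, j) * Q $$ (j, l)"] I il
        by (simp add: M_def)
      also have "\<dots> = (?P * ?Q) $$ (i, l)"
        using P' Q' il P'_index submatrix_rows_index[OF Q I(1)] I(2)
        by (simp add: scalar_prod_def atLeast0LessThan)
      finally show "M I $$ (i, l) = (?P * ?Q) $$ (i, l)" .
    qed (use P' Q' in \<open>simp_all add: M_def\<close>)
    also have "det (?P * ?Q) = det ?P * det ?Q" by (rule det_mult[OF P' Q'])
    finally show "sum g {f \<in> F {..<n}. f ` {0..<k} = I} = det ?P * det ?Q" .
  qed simp
  finally show ?thesis .
qed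

text \<open>Coordinate \<open>i\<close> of a combination of the unit vectors is the coefficient of
  \<open>unit_vec n i\<close> if \<open>i \<in> I\<close> and \<open>0\<close> otherwise; both
  inclusions can be read off from this.\<close>

lemma coordinate_plane_eq:
  assumes "I \<subseteq> {..<n}"
  shows "coordinate_plane n I = {y \<in> carrier_vec n. \<forall>i<n. i \<notin> I \<longrightarrow> y $ i = 0}"
proof -
  interpret vec_space "TYPE(real)" n .
  have fin: "finite (unit_vec n ` I :: real vec set)" using assms finite_subset by blast
  have sub: "(unit_vec n ` I :: real vec set) \<subseteq> carrier_vec n" by auto
  have inj: "inj_on (unit_vec n :: nat \<Rightarrow> real vec) I"
    using assms by (auto simp: inj_on_def)
  have idx: "lincomb a (unit_vec n ` I) $ i = (if i \<in> I then a (unit_vec n i) else 0)"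
    if i: "i < n" for a i
  proof -
    have "lincomb a (unit_vec n ` I) $ i = (\<Sum>j\<in>I. a (unit_vec n j) * unit_vec n j $ i)"
      by (simp add: lincomb_index[OF i sub] sum.reindex[OF inj])
    also have "\<dots> = (\<Sum>j\<in>I. if j = i then a (unit_vec n i) else 0)"
      using i assms by (intro sum.cong) auto
    also have "\<dots> = (if i \<in> I then a (unit_vec n i) else 0)"
      using assms finite_subset by (subst sum.delta) auto
    finally show ?thesis .
  qed
  have "y \<in> span (unit_vec n ` I)" if y: "y \<in> carrier_vec n" "\<forall>i<n. i \<notin> I \<longrightarrow> y $ i = 0" for y
  proof -
    \<comment> \<open>In \<open>lincomb\<close> the coefficients are indexed by vectors, so the
      coordinate number is recovered by inverting \<open>unit_vec n\<close> on
      \<open>I\<close>.\<close>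
    define a where "a v = y $ the_inv_into I (unit_vec n) v" for v :: "real vec"
    have "y = lincomb a (unit_vec n ` I)"
    proof (rule eq_vecI)
      show "dim_vec y = dim_vec (lincomb a (unit_vec n ` I))"
        using y lincomb_closed[OF sub, of a] by auto
      fix i assume "i < dim_vec (lincomb a (unit_vec n ` I))"
      then have "i < n" using lincomb_closed[OF sub, of a] by auto
      then show "y $ i = lincomb a (unit_vec n ` I) $ i"
        using y by (auto simp: idx a_def the_inv_into_f_f[OF inj])
    qed
    then show ?thesis unfolding finite_span[OF fin sub] by auto
  qed
  moreover have "y \<in> carrier_vec n \<and> (\<forall>i<n. i \<notin> I \<longrightarrow> y $ i = 0)"
    if "y \<in> span (unit_vec n ` I)" for y
    using that lincomb_closed[OF sub] unfolding finite_span[OF fin sub] by (auto simp: idx)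
  ultimately show ?thesis unfolding coordinate_plane_def by blast
qed

text \<open>The difference of \<open>x\<close> and the truncated vector lives outside
  \<open>I\<close>, the plane inside, so every product of coordinates is zero. Uniqueness comes from
  testing against \<open>unit_vec n i\<close> for \<open>i \<in> I\<close>.\<close>

lemma orthogonal_projection_coordinate_plane:
  assumes I: "I \<subseteq> {..<n}" and x: "x \<in> carrier_vec n"
  shows "orthogonal_projection (coordinate_plane n I) x =
    vec n (\<lambda>i. if i \<in> I then x $ i else 0)"
  unfolding orthogonal_projection_def
proof (rule the_equality)
  show "vec n (\<lambda>i. if i \<in> I then x $ i else 0) \<in> coordinate_plane n I \<and>
    (\<forall>w\<in>coordinate_plane n I. (x - vec n (\<lambda>i. if i \<in> I then x $ i else 0)) \<bullet> w = 0)"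
    using x by (auto simp: coordinate_plane_eq[OF I] scalar_prod_def intro!: sum.neutral)
next
  fix y assume y: "y \<in> coordinate_plane n I \<and> (\<forall>w\<in>coordinate_plane n I. (x - y) \<bullet> w = 0)"
  then have y_carrier: "y \<in> carrier_vec n" and y0: "\<And>i. i < n \<Longrightarrow> i \<notin> I \<Longrightarrow> y $ i = 0"
    by (auto simp: coordinate_plane_eq[OF I])
  have "x $ i = y $ i" if i: "i \<in> I" for i
  proof -
    have "i < n" using i I by auto
    have "unit_vec n i \<in> coordinate_plane n I"
      using i I by (auto simp: coordinate_plane_eq[OF I])
    then have "(x - y) $ i = 0"
      using y scalar_prod_right_unit[OF \<open>i < n\<close>, of "x - y"] by metis
    then show ?thesis using \<open>i < n\<close> y_carrier by simp
  qed
  then show "y = vec n (\<lambda>i. if i \<in> I then x $ i else 0)"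
    using y_carrier y0 by (intro eq_vecI) auto
qed

text \<open>Dropping coordinates of \<open>A *\<^sub>v l\<close> drops rows of \<open>A\<close> and
  leaves \<open>l\<close> alone, so both sides are images of the same cube of coefficient
  vectors.\<close>

lemma coordinate_projection_parallelepiped:
  assumes A: "A \<in> carrier_mat n k" and I: "I \<subseteq> {..<n}"
  shows "coordinate_projection n I ` parallelepiped A = parallelepiped (submatrix A I UNIV)"
proof -
  have "coordinate_projection n I (A *\<^sub>v l) = submatrix A I UNIV *\<^sub>v l"
    if l: "l \<in> carrier_vec k" for l
  proof (rule eq_vecI)
    fix i assume "i < dim_vec (submatrix A I UNIV *\<^sub>v l)"
    then have i: "i < card I" using submatrix_rows_carrier[OF A I] by simp
    then have p: "pick I i \<in> I" "pick I i < n" using pick_in_set_le I by auto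
    have "row (submatrix A I UNIV) i = row A (pick I i)"
      using A i p submatrix_rows_carrier[OF A I] submatrix_rows_index[OF A I]
      by (intro eq_vecI) auto
    then show "coordinate_projection n I (A *\<^sub>v l) $ i = (submatrix A I UNIV *\<^sub>v l) $ i"
      using A l i p submatrix_rows_carrier[OF A I]
      by (simp add: coordinate_projection_def plane_coordinates_def
          orthogonal_projection_coordinate_plane[OF I mult_mat_vec_carrier[OF A l]])
  qed (use submatrix_rows_carrier[OF A I] in
      \<open>simp add: coordinate_projection_def plane_coordinates_def\<close>)
  moreover have "dim_col (submatrix A I UNIV) = k" "dim_col A = k"
    using A submatrix_rows_carrier[OF A I] by auto
  ultimately show ?thesis
    unfolding parallelepiped_def by (simp add: setcompr_eq_image image_image cong: image_cong_simp)
qed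

theorem theorem1:
  fixes A :: "real mat" and n k :: nat
  assumes "A \<in> carrier_mat n k"
  shows "det (A\<^sup>T * A) = (\<Sum>I | I \<subseteq> {..<n} \<and> card I = k. (det (submatrix A I UNIV))\<^sup>2) \<and>
         (parallelepiped_content k (parallelepiped A))\<^sup>2 =
           (\<Sum>I | I \<subseteq> {..<n} \<and> card I = k.
              (parallelepiped_content k (coordinate_projection n I ` parallelepiped A))\<^sup>2)"
proof -
  let ?S = "{I. I \<subseteq> {..<n} \<and> card I = k}"
  have sub: "submatrix A I UNIV \<in> carrier_mat k k" if "I \<in> ?S" for I
    using that submatrix_rows_carrier[OF assms, of I] by auto
  have tr: "submatrix A\<^sup>T UNIV I = (submatrix A I UNIV)\<^sup>T" if "I \<in> ?S" for I
  proof -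
    have "pick I i < n" if "i < card {i. i < n \<and> i \<in> I}" for i using pick_le[OF that] .
    then show ?thesis using assms
      by (intro eq_matI) (auto simp: submatrix_def pick_UNIV)
  qed
  have gram: "det (A\<^sup>T * A) = (\<Sum>I\<in>?S. (det (submatrix A I UNIV))\<^sup>2)"
    unfolding Cauchy_Binet[OF transpose_carrier_mat[THEN iffD2, OF assms] assms]
    by (intro sum.cong refl) (simp add: tr det_transpose[OF sub] power2_eq_square)
  \<comment> \<open>Squaring undoes the root only for a nonnegative determinant; \<open>gram\<close>
    shows this by writing it as a sum of squares.\<close>
  have "(parallelepiped_content k (parallelepiped A))\<^sup>2 = det (A\<^sup>T * A)"
    by (simp add: parallelepiped_content_eq[OF assms] gram sum_nonneg)
  also have "\<dots> = (\<Sum>I\<in>?S.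
      (parallelepiped_content k (coordinate_projection n I ` parallelepiped A))\<^sup>2)"
    unfolding gram
  proof (rule sum.cong)
    fix I assume I: "I \<in> ?S"
    let ?B = "submatrix A I UNIV"
    have "det (?B\<^sup>T * ?B) = (det ?B)\<^sup>2"
      using sub[OF I] by (simp add: det_mult det_transpose power2_eq_square)
    then show "(det ?B)\<^sup>2 =
        (parallelepiped_content k (coordinate_projection n I ` parallelepiped A))\<^sup>2"
      using I by (simp add: coordinate_projection_parallelepiped[OF assms]
          parallelepiped_content_eq[OF sub[OF I]])
  qed simp
  finally show ?thesis using gram by blast
qed

end
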